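(* Let $K,M,N\in\mathcal{M}$ be three means satisfying $K(x,y)<M(x,y)<N(x,y)$ for all distinct $x,y>0$, and let $\mu,\nu\in\mathbb{R}$. The inequalities $$(1-\mu)K(x,y)+\mu N(x,y)\leqslant M(x,y)\leqslant(1-\nu)K(x,y)+\nu N(x,y)$$ hold for all $x,y>0$ if and only if $$\mu\leqslant\inf_{0<z<1}\frac{\frac{1}{f_M(z)}-\frac{1}{f_K(z)}}{\frac{1}{f_N(z)}-\frac{1}{f_K(z)}}\quad\text{and}\quad\sup_{0<z<1}\frac{\frac{1}{f_M(z)}-\frac{1}{f_K(z)}}{\frac{1}{f_N(z)}-\frac{1}{f_K(z)}}\leqslant\nu.$$
   Context: $\mathbb{R}_+=(0,\infty)$. $\mathcal{M}$ is the set of functions $M:\mathbb{R}_+^2\to\mathbb{R}$ (called means) that are symmetric, positively homogeneous of order $1$ ($M(\lambda x,\lambda y)=\lambda M(x,y)$ for $\lambda>0$), and satisfy $\min(x,y)\leqslant M(x,y)\leqslant\max(x,y)$. For $M\in\mathcal{M}$, its Seiffert function is $f_M(z)=\frac{z}{M(1+z,1-z)}$, $z\in(0,1)$. *)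

theory Defs
  imports Complex_Main
begin

text \<open>
  A mean is a function on pairs of positive reals. It is represented by a total function on
  \<^typ>\<open>real\<close>, whose values at arguments that are not both positive are unconstrained.
\<close>

definition means :: "(real \<Rightarrow> real \<Rightarrow> real) set" where
  "means = {M.
     (\<forall>x>0. \<forall>y>0. M x y = M y x) \<and>
     (\<forall>x>0. \<forall>y>0. \<forall>c>0. M (c * x) (c * y) = c * M x y) \<and>
     (\<forall>x>0. \<forall>y>0. min x y \<le> M x y \<and> M x y \<le> max x y)}"

text \<open>The Seiffert function of a mean is only meaningful for arguments between 0 and 1.\<close>

definition seiffert :: "(real \<Rightarrow> real \<Rightarrow> real) \<Rightarrow> real \<Rightarrow> real" where
  "seiffert M z = z / M (1 + z) (1 - z)"

end

theory Submission
  imports Defs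
begin

text \<open>
  For distinct arguments, both inequalities bound the relative position
  \<open>(M - K) / (N - K)\<close> of \<open>M\<close> between \<open>K\<close> and \<open>N\<close>: it must lie between \<open>\<mu>\<close> and \<open>\<nu>\<close>. This quotient
  is symmetric and homogeneous of order 0, so all its values are taken at the pairs
  \<open>(1 + z, 1 - z)\<close> with \<open>0 < z < 1\<close> (lemma \<open>mean_eq_scaled\<close>). There \<open>1 / f\<^sub>M(z) = M(1 + z, 1 - z) / z\<close>,
  the factors \<open>1 / z\<close> cancel, and the quotient is the one of the theorem. Since
  \<open>K < M < N\<close>, its values lie in \<open>(0, 1)\<close>. Hence the infimum and the supremum are those of a
  nonempty bounded set, and comparing them with \<open>\<mu>\<close> and \<open>\<nu>\<close> is the same as comparing every value.
  On the diagonal all means coincide and the inequalities are equalities.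
\<close>

lemma mean_diagonal:
  assumes "M \<in> means" "x > 0"
  shows "M x x = x"
proof -
  have "min x x \<le> M x x \<and> M x x \<le> max x x"
    using assms unfolding means_def by blast
  then show ?thesis by simp
qed

text \<open>
  A pair of positive numbers is, up to order, its arithmetic mean times \<open>(1 + z, 1 - z)\<close>,
  where \<open>z\<close> is the distance of the numbers relative to their sum.
\<close>

lemma mean_eq_scaled:
  assumes M: "M \<in> means" and xy: "x > 0" "y > 0"
  defines "z \<equiv> \<bar>x - y\<bar> / (x + y)"
  shows "M x y = (x + y) / 2 * M (1 + z) (1 - z)"
proof -
  have sym: "M x y = M y x"
    using M xy unfolding means_def by blast
  have z1: "z < 1" and z0: "z \<ge> 0"
    using xy by (auto simp: z_def field_simps abs_if)
  have hom: "M ((x + y) / 2 * (1 + z)) ((x + y) / 2 * (1 - z)) = (x + y) / 2 * M (1 + z) (1 - z)"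
  proof -
    have "1 + z > 0" "1 - z > 0" "(x + y) / 2 > 0" using z0 z1 xy by auto
    then show ?thesis using M unfolding means_def by blast
  qed
  have "(x + y) * z = \<bar>x - y\<bar>"
    using xy by (simp add: z_def)
  moreover have "(x + y) / 2 * (1 + z) = (x + y + (x + y) * z) / 2"
    "(x + y) / 2 * (1 - z) = (x + y - (x + y) * z) / 2"
    by (simp_all add: algebra_simps)
  ultimately have "(x + y) / 2 * (1 + z) = max x y" "(x + y) / 2 * (1 - z) = min x y"
    by (auto simp: max_def min_def abs_if)
  then show ?thesis
    using hom sym by (simp add: max_def min_def split: if_splits)
qed

lemma seiffert_quotient:
  assumes "z \<noteq> 0"
  shows "(1 / seiffert M z - 1 / seiffert K z) / (1 / seiffert N z - 1 / seiffert K z) =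
         (M (1 + z) (1 - z) - K (1 + z) (1 - z)) / (N (1 + z) (1 - z) - K (1 + z) (1 - z))"
  using assms by (simp add: seiffert_def flip: diff_divide_distrib)

text \<open>
  The hypothesis \<open>k < n\<close> makes it possible to solve both inequalities for their coefficients.
\<close>

lemma between_convex_combinations_iff:
  fixes k m n \<mu> \<nu> :: real
  assumes "k < n"
  shows "(1 - \<mu>) * k + \<mu> * n \<le> m \<and> m \<le> (1 - \<nu>) * k + \<nu> * n \<longleftrightarrow>
         \<mu> \<le> (m - k) / (n - k) \<and> (m - k) / (n - k) \<le> \<nu>"
proof -
  have "n - k > 0" using assms by simp
  then show ?thesis
    by (simp add: pos_le_divide_eq pos_divide_le_eq) (auto simp: algebra_simps)
qed

theorem theorem8p1:
  fixes K M N :: "real \<Rightarrow> real \<Rightarrow> real" and \<mu> \<nu> :: real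
  assumes "K \<in> means" and "M \<in> means" and "N \<in> means"
    and "\<And>x y. x > 0 \<Longrightarrow> y > 0 \<Longrightarrow> x \<noteq> y \<Longrightarrow> K x y < M x y \<and> M x y < N x y"
  shows "(\<forall>x>0. \<forall>y>0. (1 - \<mu>) * K x y + \<mu> * N x y \<le> M x y \<and>
                       M x y \<le> (1 - \<nu>) * K x y + \<nu> * N x y)
     \<longleftrightarrow>
     \<mu> \<le> (INF z\<in>{0<..<1}. (1 / seiffert M z - 1 / seiffert K z) /
                           (1 / seiffert N z - 1 / seiffert K z)) \<and>
     (SUP z\<in>{0<..<1}. (1 / seiffert M z - 1 / seiffert K z) /
                       (1 / seiffert N z - 1 / seiffert K z)) \<le> \<nu>"
proof -
  let ?I = "{0<..<1::real}"
  define q where "q z = (1 / seiffert M z - 1 / seiffert K z) /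
                        (1 / seiffert N z - 1 / seiffert K z)" for z
  have KMN: "K (1 + z) (1 - z) < M (1 + z) (1 - z) \<and> M (1 + z) (1 - z) < N (1 + z) (1 - z)"
    if "z \<in> ?I" for z
    using assms(4)[of "1 + z" "1 - z"] that by auto
  have q_eq: "q z = (M (1 + z) (1 - z) - K (1 + z) (1 - z)) / (N (1 + z) (1 - z) - K (1 + z) (1 - z))"
    if "z \<in> ?I" for z
    using that by (auto simp: q_def intro: seiffert_quotient)
  have "0 \<le> q z \<and> q z \<le> 1" if "z \<in> ?I" for z
    using KMN[OF that] by (simp add: q_eq[OF that])
  then have bdd: "bdd_below (q ` ?I)" "bdd_above (q ` ?I)"
    by (auto intro!: bdd_belowI2[of _ 0] bdd_aboveI2[of _ _ 1])

  define P where "P x y \<longleftrightarrow> (1 - \<mu>) * K x y + \<mu> * N x y \<le> M x y \<and>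
                            M x y \<le> (1 - \<nu>) * K x y + \<nu> * N x y" for x y
  have P_iff: "P (1 + z) (1 - z) \<longleftrightarrow> \<mu> \<le> q z \<and> q z \<le> \<nu>" if "z \<in> ?I" for z
    unfolding P_def q_eq[OF that]
    by (rule between_convex_combinations_iff) (use KMN[OF that] in simp)

  have "(\<forall>x>0. \<forall>y>0. P x y) \<longleftrightarrow> (\<forall>z\<in>?I. P (1 + z) (1 - z))"
  proof (intro iffI allI impI)
    assume *: "\<forall>z\<in>?I. P (1 + z) (1 - z)"
    fix x y :: real
    assume xy: "x > 0" "y > 0"
    show "P x y"
    proof (cases "x = y")
      case True
      then show ?thesis
        using xy assms(1-3) by (simp add: P_def mean_diagonal algebra_simps)
    next
      case False
      define z where "z = \<bar>x - y\<bar> / (x + y)"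
      define c where "c = (x + y) / 2"
      have "z \<in> ?I"
        using xy False by (auto simp: z_def field_simps abs_if)
      then have P: "P (1 + z) (1 - z)" using * by blast
      have "c > 0" using xy by (simp add: c_def)
      have scaled: "L x y = c * L (1 + z) (1 - z)" if "L \<in> means" for L
        unfolding c_def z_def using mean_eq_scaled[OF that xy] .
      have lin: "(1 - t) * K x y + t * N x y =
                 c * ((1 - t) * K (1 + z) (1 - z) + t * N (1 + z) (1 - z))" for t
        by (simp add: scaled[OF assms(1)] scaled[OF assms(3)] algebra_simps)
      show ?thesis
        using P \<open>c > 0\<close> unfolding P_def lin scaled[OF assms(2)]
        by (simp add: mult_le_cancel_left_pos)
    qed
  qed auto
  also have "\<dots> \<longleftrightarrow> (\<forall>z\<in>?I. \<mu> \<le> q z) \<and> (\<forall>z\<in>?I. q z \<le> \<nu>)"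
    using P_iff by blast
  also have "\<dots> \<longleftrightarrow> \<mu> \<le> (INF z\<in>?I. q z) \<and> (SUP z\<in>?I. q z) \<le> \<nu>"
    using bdd by (simp add: le_cINF_iff cSUP_le_iff)
  finally show ?thesis
    unfolding P_def q_def .
qed

end
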